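(* Let $n\ge 1$, $t_0\in\mathbb{R}$, and let $P,Q,R,S:[t_0,+\infty)\to\mathbb{C}^{n\times n}$ be continuous. Let $t_1\ge t_0$ and consider the matrix Riccati equation $$Z'+ZP(t)Z+Q(t)Z+ZR(t)+S(t)=0,\qquad t\ge t_0. \quad (\mathrm{E})$$ Suppose that for some $t_1$-regular solution $Z_0(t)$ of (E) the integral $\nu_{Z_0}(t_1)$ is convergent and $\det\nu_{Z_0}(t)\ne0$ for all $t\ge t_1$. Then the following statements are valid. a) The matrix function $$Z_*(t)=Z_0(t)-[\Phi_{Z_0}(t)\,\nu_{Z_0}(t)\,\Psi_{Z_0}(t)]^{-1},\qquad t\ge t_1,$$ is a $t_1$-extremal solution of (E). b) $\nu_{Z_*}(t)=\infty$ for all $t\ge t_1$, i.e. $\left\|\int_{t}^{T}\Phi_{Z_*}^{-1}(\tau)P(\tau)\Psi_{Z_*}^{-1}(\tau)\,d\tau\right\|\to+\infty$ as $T\to+\infty$. c) For every $t_1$-normal solution $Z_N(t)$ of (E) the equality $$\int_{t_1}^{+\infty}\mathrm{Re}\,\mathrm{tr}\,[P(\tau)(Z_*(\tau)-Z_N(\tau))]\,d\tau=-\infty$$ is valid.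
   Context: Standing assumption: there is some $t_1'\ge t_0$ for which (E) has at least two $t_1'$-regular solutions. A solution $Z(t)$ of (E) is called $t_1$-regular if it exists on $[t_1,+\infty)$. A $t_1$-regular solution $Z(t)$ is called $t_1$-normal if there exists a neighborhood $U(Z(t_1))$ of $Z(t_1)$ in $\mathbb{C}^{n\times n}$ such that every solution $\widetilde Z(t)$ of (E) with $\widetilde Z(t_1)\in U(Z(t_1))$ is also $t_1$-regular; otherwise $Z(t)$ is called $t_1$-extremal. For a $t_1$-regular solution $Z(t)$ of (E), $\Phi_Z(t)$ and $\Psi_Z(t)$ denote the solutions on $[t_1,+\infty)$ of the linear matrix equations $$\Phi'=[P(t)Z(t)+R(t)]\Phi,\qquad \Psi'=\Psi[Z(t)P(t)+Q(t)]$$ with $\Phi_Z(t_1)=\Psi_Z(t_1)=I$ (the $n\times n$ identity matrix); both are invertible for all $t\ge t_1$. Further, $$\nu_Z(t)=\int_{t}^{+\infty}\Phi_Z^{-1}(\tau)P(\tau)\Psi_Z^{-1}(\tau)\,d\tau,\qquad t\ge t_1,$$ understood as an improper integral (limit of $\int_t^T$ as $T\to+\infty$); if it converges for one $t\ge t_1$ it converges for all $t\ge t_1$. $\|\cdot\|$ is any matrix norm. *)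

theory Defs
  imports "HOL-Analysis.Analysis"
begin

text \<open>
  All derivatives are taken within the interval of definition, i.e. they are one-sided at an
  endpoint belonging to it. A solution is a pair of a nondegenerate interval and a function
  whose values outside that interval are irrelevant.
\<close>

definition riccati_solution_on ::
  "(real \<Rightarrow> complex^'n^'n) \<Rightarrow> (real \<Rightarrow> complex^'n^'n) \<Rightarrow> (real \<Rightarrow> complex^'n^'n) \<Rightarrow>
   (real \<Rightarrow> complex^'n^'n) \<Rightarrow> real \<Rightarrow> real set \<Rightarrow> (real \<Rightarrow> complex^'n^'n) \<Rightarrow> bool" where
  "riccati_solution_on P Q R S t0 I Z \<longleftrightarrow>
     is_interval I \<and> interior I \<noteq> {} \<and> I \<subseteq> {t0..} \<and>
     (\<forall>t\<in>I. \<exists>Z'. (Z has_vector_derivative Z') (at t within I) \<and>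
        Z' + Z t ** P t ** Z t + Q t ** Z t + Z t ** R t + S t = 0)"

definition riccati_regular ::
  "(real \<Rightarrow> complex^'n^'n) \<Rightarrow> (real \<Rightarrow> complex^'n^'n) \<Rightarrow> (real \<Rightarrow> complex^'n^'n) \<Rightarrow>
   (real \<Rightarrow> complex^'n^'n) \<Rightarrow> real \<Rightarrow> real \<Rightarrow> (real \<Rightarrow> complex^'n^'n) \<Rightarrow> bool" where
  "riccati_regular P Q R S t0 t1 Z \<longleftrightarrow> riccati_solution_on P Q R S t0 {t1..} Z"

text \<open>
  In the definition of normality, the solutions starting in the neighbourhood are a priori
  only local: \<open>W\<close> is a solution on some interval \<open>I\<close> containing \<open>t1\<close>. That it is regular means
  that it exists up to infinity, i.e. that it continues to a solution on \<open>I \<union> {t1..}\<close>.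
\<close>

definition riccati_normal ::
  "(real \<Rightarrow> complex^'n^'n) \<Rightarrow> (real \<Rightarrow> complex^'n^'n) \<Rightarrow> (real \<Rightarrow> complex^'n^'n) \<Rightarrow>
   (real \<Rightarrow> complex^'n^'n) \<Rightarrow> real \<Rightarrow> real \<Rightarrow> (real \<Rightarrow> complex^'n^'n) \<Rightarrow> bool" where
  "riccati_normal P Q R S t0 t1 Z \<longleftrightarrow>
     riccati_regular P Q R S t0 t1 Z \<and>
     (\<exists>U. open U \<and> Z t1 \<in> U \<and>
        (\<forall>I W. riccati_solution_on P Q R S t0 I W \<and> t1 \<in> I \<and> W t1 \<in> U \<longrightarrow>
           (\<exists>V. riccati_solution_on P Q R S t0 (I \<union> {t1..}) V \<and> (\<forall>t\<in>I. V t = W t))))"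

definition riccati_extremal ::
  "(real \<Rightarrow> complex^'n^'n) \<Rightarrow> (real \<Rightarrow> complex^'n^'n) \<Rightarrow> (real \<Rightarrow> complex^'n^'n) \<Rightarrow>
   (real \<Rightarrow> complex^'n^'n) \<Rightarrow> real \<Rightarrow> real \<Rightarrow> (real \<Rightarrow> complex^'n^'n) \<Rightarrow> bool" where
  "riccati_extremal P Q R S t0 t1 Z \<longleftrightarrow>
     riccati_regular P Q R S t0 t1 Z \<and> \<not> riccati_normal P Q R S t0 t1 Z"

text \<open>
  The two linear initial value problems determine their solutions on \<open>{t1..}\<close> only, hence the
  choice operator; the values before \<open>t1\<close> are never used.
\<close>

definition Phi_sol ::
  "(real \<Rightarrow> complex^'n^'n) \<Rightarrow> (real \<Rightarrow> complex^'n^'n) \<Rightarrow> real \<Rightarrow> (real \<Rightarrow> complex^'n^'n) \<Rightarrow>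
   real \<Rightarrow> complex^'n^'n" where
  "Phi_sol P R t1 Z = (SOME \<Phi>. \<Phi> t1 = mat 1 \<and>
     (\<forall>t\<ge>t1. (\<Phi> has_vector_derivative (P t ** Z t + R t) ** \<Phi> t) (at t within {t1..})))"

definition Psi_sol ::
  "(real \<Rightarrow> complex^'n^'n) \<Rightarrow> (real \<Rightarrow> complex^'n^'n) \<Rightarrow> real \<Rightarrow> (real \<Rightarrow> complex^'n^'n) \<Rightarrow>
   real \<Rightarrow> complex^'n^'n" where
  "Psi_sol P Q t1 Z = (SOME \<Psi>. \<Psi> t1 = mat 1 \<and>
     (\<forall>t\<ge>t1. (\<Psi> has_vector_derivative \<Psi> t ** (Z t ** P t + Q t)) (at t within {t1..})))"

definition nu_partial ::
  "(real \<Rightarrow> complex^'n^'n) \<Rightarrow> (real \<Rightarrow> complex^'n^'n) \<Rightarrow> (real \<Rightarrow> complex^'n^'n) \<Rightarrow> real \<Rightarrow>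
   (real \<Rightarrow> complex^'n^'n) \<Rightarrow> real \<Rightarrow> real \<Rightarrow> complex^'n^'n" where
  "nu_partial P Q R t1 Z t T =
     integral {t..T}
       (\<lambda>\<tau>. matrix_inv (Phi_sol P R t1 Z \<tau>) ** P \<tau> ** matrix_inv (Psi_sol P Q t1 Z \<tau>))"

definition nu_convergent ::
  "(real \<Rightarrow> complex^'n^'n) \<Rightarrow> (real \<Rightarrow> complex^'n^'n) \<Rightarrow> (real \<Rightarrow> complex^'n^'n) \<Rightarrow> real \<Rightarrow>
   (real \<Rightarrow> complex^'n^'n) \<Rightarrow> real \<Rightarrow> bool" where
  "nu_convergent P Q R t1 Z t \<longleftrightarrow> (\<exists>L. (nu_partial P Q R t1 Z t \<longlongrightarrow> L) at_top)"

definition nu ::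
  "(real \<Rightarrow> complex^'n^'n) \<Rightarrow> (real \<Rightarrow> complex^'n^'n) \<Rightarrow> (real \<Rightarrow> complex^'n^'n) \<Rightarrow> real \<Rightarrow>
   (real \<Rightarrow> complex^'n^'n) \<Rightarrow> real \<Rightarrow> complex^'n^'n" where
  "nu P Q R t1 Z t = Lim at_top (nu_partial P Q R t1 Z t)"

text \<open>
  Submultiplicativity is not required, so that matrix norms in both usual senses are covered.
\<close>

definition is_matrix_norm :: "(complex^'n^'n \<Rightarrow> real) \<Rightarrow> bool" where
  "is_matrix_norm N \<longleftrightarrow>
     (\<forall>A. 0 \<le> N A) \<and> (\<forall>A. N A = 0 \<longleftrightarrow> A = 0) \<and>
     (\<forall>c A. N (\<chi> i j. c * A $ i $ j) = cmod c * N A) \<and>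
     (\<forall>A B. N (A + B) \<le> N A + N B)"

end

theory Submission
  imports Defs
begin

text \<open>
  Put \<open>K = \<Phi>\<^sup>-\<^sup>1 P \<Psi>\<^sup>-\<^sup>1\<close> (for \<open>Z0\<close>), \<open>M(t) = \<integral> K\<close> over \<open>[t1, t]\<close> and \<open>N = lim M = \<nu>(t1)\<close>. The solution starting at
  \<open>Z0(t1) + \<Lambda>\<close> is \<open>Z0 + \<Psi>\<^sup>-\<^sup>1 \<Lambda> (1 + M \<Lambda>)\<^sup>-\<^sup>1 \<Phi>\<^sup>-\<^sup>1\<close>, its fundamental matrices are \<open>\<Phi> (1 + M \<Lambda>)\<close> and
  \<open>(1 + \<Lambda> M) \<Psi>\<close>, and it is regular iff \<open>1 + M(t) \<Lambda>\<close> never becomes singular. The function \<open>Zs\<close>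
  is the solution with \<open>\<Lambda> = - N\<^sup>-\<^sup>1\<close>, and then \<open>1 + M \<Lambda> = \<nu> N\<^sup>-\<^sup>1\<close> tends to zero. Singularity of
  \<open>\<Lambda> + N\<^sup>-\<^sup>1\<close> excludes normality, since arbitrarily small perturbations of \<open>\<Lambda>\<close> make \<open>1 + M(t) \<Lambda>\<close>
  singular for some large \<open>t\<close>. Part b follows from \<open>\<nu>\<^bsub>Zs\<^esub> = \<integral> N (\<nu>\<^sup>-\<^sup>1)' N\<close>, part c from Liouville's
  formula applied to the quotient of the determinants of \<open>\<nu> N\<^sup>-\<^sup>1\<close> and \<open>1 + M \<Lambda>\<close>.
\<close>

section \<open>Linear matrix differential equations\<close>

text \<open>The solution is the sum of the Picard terms \<open>p k\<close>, each the integral of the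
  coefficient applied to the previous one; the factorial bound \<open>bd\<close> makes the series
  uniformly convergent on compact intervals. A general bilinear \<open>prod\<close> lets one
  argument serve coefficients multiplying from the left and from the right.\<close>

lemma linear_ode_exists:
  fixes prod :: "'a::real_normed_vector \<Rightarrow> 'b::banach \<Rightarrow> 'b" and A :: "real \<Rightarrow> 'a"
  assumes bil: "bounded_bilinear prod" and contA: "continuous_on {a..} A"
  obtains x where "x a = x0"
    and "\<And>t. a \<le> t \<Longrightarrow> (x has_vector_derivative prod (A t) (x t)) (at t within {a..})"
proof -
  interpret bounded_bilinear prod by (rule bil)
  define p where "p = rec_nat (\<lambda>t. x0) (\<lambda>k f t. integral {a..t} (\<lambda>s. prod (A s) (f s)))"
  define \<phi> where "\<phi> t = (\<Sum>k. p k t)" for t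
  have p0: "p 0 = (\<lambda>t. x0)" and pSuc: "p (Suc k) = (\<lambda>t. integral {a..t} (\<lambda>s. prod (A s) (p k s)))" for k
    by (auto simp: p_def)
  have contAb: "continuous_on {a..b} A" for b
    using contA by (rule continuous_on_subset) auto
  have contp: "continuous_on {a..b} (p k)" for k b
  proof (induction k)
    case (Suc k)
    then show ?case
      unfolding pSuc
      by (intro indefinite_integral_continuous_1 integrable_continuous_real continuous_on contAb)
  qed (simp add: p0)
  have cont_step: "continuous_on {a..b} (\<lambda>s. prod (A s) (p k s))" for k b
    by (intro continuous_on contAb contp)
  \<comment> \<open>Bounds on \<open>A\<close> exist on compact intervals only, so the integral
    equation is derived on each \<open>{a..b}\<close>; the series \<phi> itself does not depend on
    \<open>b\<close>.\<close>
  have main: "\<phi> t = x0 + integral {a..t} (\<lambda>s. prod (A s) (\<phi> s)) \<and>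
      continuous_on {a..b} \<phi>" if t: "t \<in> {a..b}" for t b
  proof -
    have "bounded (A ` {a..b})"
      by (intro compact_imp_bounded compact_continuous_image contAb) auto
    then obtain B where B: "B > 0" "\<And>s. s \<in> {a..b} \<Longrightarrow> norm (A s) \<le> B"
      by (auto simp: bounded_pos)
    obtain L where L: "L > 0" "\<And>x y. norm (prod x y) \<le> norm x * norm y * L"
      using pos_bounded by blast
    define C where "C = B * L"
    have "C > 0" using B L by (simp add: C_def)
    have C: "norm (prod (A s) y) \<le> C * norm y" if "s \<in> {a..b}" for s y
    proof -
      have "norm (prod (A s) y) \<le> norm (A s) * norm y * L" by (rule L)
      also have "\<dots> \<le> B * norm y * L" using B(2)[OF that] L by (intro mult_right_mono) auto
      finally show ?thesis by (simp add: C_def mult_ac)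
    qed
    have bd: "norm (p k s) \<le> C^k * (s - a)^k / fact k * norm x0" if "s \<in> {a..b}" for k s
      using that
    proof (induction k arbitrary: s)
      case (Suc k)
      have d: "((\<lambda>u. C ^ Suc k * (u - a) ^ Suc k / fact (Suc k) * norm x0) has_vector_derivative
          C * (C^k * (u - a)^k / fact k * norm x0)) (at u within {a..s})" for u
      proof -
        define c where "c = C ^ Suc k / fact (Suc k) * norm x0"
        have "c * real (Suc k) = C * C^k / fact k * norm x0"
          by (simp add: c_def divide_simps del: of_nat_Suc)
        moreover have "((\<lambda>u. c * (u - a) ^ Suc k) has_real_derivative c * (real (Suc k) * (u - a)^k)) (at u within {a..s})"
          by (auto intro!: derivative_eq_intros simp del: of_nat_Suc power_Suc)
        ultimately show ?thesis
          unfolding has_real_derivative_iff_has_vector_derivative mult.assoc[symmetric]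
          by (simp add: c_def mult_ac del: of_nat_Suc power_Suc fact_Suc)
      qed
      have "((\<lambda>u. C * (C^k * (u - a)^k / fact k * norm x0)) has_integral
          (C ^ Suc k * (s - a) ^ Suc k / fact (Suc k) * norm x0
            - C ^ Suc k * (a - a) ^ Suc k / fact (Suc k) * norm x0)) {a..s}"
        using Suc.prems by (intro fundamental_theorem_of_calculus d) auto
      then have I: "((\<lambda>u. C * (C^k * (u - a)^k / fact k * norm x0)) has_integral
          C ^ Suc k * (s - a) ^ Suc k / fact (Suc k) * norm x0) {a..s}"
        by simp
      have "norm (p (Suc k) s) \<le> integral {a..s} (\<lambda>u. C * (C^k * (u - a)^k / fact k * norm x0))"
        unfolding pSuc
      proof (rule integral_norm_bound_integral)
        fix u assume "u \<in> {a..s}"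
        then have u: "u \<in> {a..b}" using Suc.prems by auto
        have "norm (prod (A u) (p k u)) \<le> C * norm (p k u)" by (rule C[OF u])
        also have "\<dots> \<le> C * (C^k * (u - a)^k / fact k * norm x0)"
          using Suc.IH[OF u] \<open>C > 0\<close> by (intro mult_left_mono) auto
        finally show "norm (prod (A u) (p k u)) \<le> C * (C^k * (u - a)^k / fact k * norm x0)" .
      qed (use I cont_step in \<open>auto intro: integrable_continuous_real\<close>)
      also have "\<dots> = C ^ Suc k * (s - a) ^ Suc k / fact (Suc k) * norm x0"
        using I by (rule integral_unique)
      finally show ?case .
    qed (simp add: p0)
    have lim: "uniform_limit {a..b} (\<lambda>n s. \<Sum>i<n. p i s) \<phi> sequentially"
      unfolding \<phi>_def
    proof (rule Weierstrass_m_test)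
      fix n s assume s: "s \<in> {a..b}"
      have "norm (p n s) \<le> C^n * (s - a)^n / fact n * norm x0" by (rule bd[OF s])
      also have "\<dots> \<le> C^n * (b - a)^n / fact n * norm x0"
        using s \<open>C > 0\<close> by (intro mult_right_mono divide_right_mono mult_left_mono power_mono) auto
      also have "\<dots> = inverse (fact n) * (C * (b - a))^n * norm x0"
        by (simp add: power_mult_distrib divide_inverse)
      finally show "norm (p n s) \<le> inverse (fact n) * (C * (b - a))^n * norm x0" .
    next
      show "summable (\<lambda>n. inverse (fact n) * (C * (b - a))^n * norm x0)"
        by (intro summable_mult2 summable_exp)
    qed
    have cont\<phi>: "continuous_on {a..b} \<phi>"
      by (rule uniform_limit_theorem[OF _ lim]) (auto intro!: always_eventually continuous_on_sum contp)
    have "bounded (\<phi> ` {a..b})"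
      by (intro compact_imp_bounded compact_continuous_image cont\<phi>) auto
    then have lim2: "uniform_limit {a..b} (\<lambda>n s. prod (A s) (\<Sum>i<n. p i s)) (\<lambda>s. prod (A s) (\<phi> s)) sequentially"
      using \<open>bounded (A ` {a..b})\<close>
      by (intro bounded_uniform_limit uniform_limit_const lim)
    have "uniform_limit {a..t} (\<lambda>n s. prod (A s) (\<Sum>i<n. p i s)) (\<lambda>s. prod (A s) (\<phi> s)) sequentially"
      by (rule uniform_limit_on_subset[OF lim2]) (use t in auto)
    moreover have "continuous_on {a..t} (\<lambda>s. prod (A s) (\<Sum>i<n. p i s))" for n
      by (intro continuous_on contAb continuous_on_sum contp)
    ultimately obtain I J where IJ: "\<And>n. ((\<lambda>s. prod (A s) (\<Sum>i<n. p i s)) has_integral I n) {a..t}"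
        "((\<lambda>s. prod (A s) (\<phi> s)) has_integral J) {a..t}" "I \<longlonglongrightarrow> J"
      by (rule uniform_limit_integral, simp) (rule that)
    \<comment> \<open>The partial sum with one more term is \<open>x0\<close> plus the integral over
      the shorter partial sum, so passing to the limit gives the integral equation.\<close>
    have "(\<Sum>i<Suc n. p i t) = x0 + I n" for n
    proof -
      have "(\<Sum>i<Suc n. p i t) = x0 + (\<Sum>i<n. integral {a..t} (\<lambda>s. prod (A s) (p i s)))"
        by (simp add: sum.lessThan_Suc_shift p0 pSuc del: sum.lessThan_Suc)
      also have "(\<Sum>i<n. integral {a..t} (\<lambda>s. prod (A s) (p i s)))
          = integral {a..t} (\<lambda>s. \<Sum>i<n. prod (A s) (p i s))"
        by (intro integral_sum[symmetric] integrable_continuous_real cont_step) auto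
      also have "\<dots> = I n" using IJ(1)[of n] by (simp add: sum_right integral_unique)
      finally show ?thesis .
    qed
    moreover have "(\<lambda>n. x0 + I n) \<longlonglongrightarrow> x0 + J" by (intro tendsto_intros IJ)
    moreover have "(\<lambda>n. \<Sum>i<Suc n. p i t) \<longlonglongrightarrow> \<phi> t"
      using tendsto_uniform_limitI[OF lim t] by (rule LIMSEQ_Suc)
    ultimately have "\<phi> t = x0 + J" by (metis (no_types, lifting) LIMSEQ_unique ext)
    with IJ cont\<phi> show ?thesis by (simp add: integral_unique)
  qed
  show thesis
  proof
    show "\<phi> a = x0" using main[of a a] by simp
    fix t assume t: "a \<le> t"
    \<comment> \<open>The interval reaches beyond \<open>t\<close>, so that derivatives within it
      and within \<open>{a..}\<close> agree at \<open>t\<close>.\<close>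
    have t': "t \<in> {a..t+1}" using t by auto
    have "((\<lambda>u. integral {a..u} (\<lambda>s. prod (A s) (\<phi> s))) has_vector_derivative prod (A t) (\<phi> t))
        (at t within {a..t+1})"
      by (rule integral_has_vector_derivative[OF _ t'])
         (use main[OF t'] in \<open>auto intro: continuous_on contAb\<close>)
    then have "((\<lambda>u. x0 + integral {a..u} (\<lambda>s. prod (A s) (\<phi> s))) has_vector_derivative prod (A t) (\<phi> t))
        (at t within {a..t+1})"
      by (auto intro!: derivative_eq_intros)
    then have "(\<phi> has_vector_derivative prod (A t) (\<phi> t)) (at t within {a..t+1})"
      by (rule has_vector_derivative_transform[rotated 2]) (use main t' in auto)
    also have "at t within {a..t+1} = at t within {a..}"
      by (rule at_within_nhd[of _ "{..<t+1}"]) auto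
    finally show "(\<phi> has_vector_derivative prod (A t) (\<phi> t)) (at t within {a..})" .
  qed
qed

section \<open>Calculus of matrix products, determinants and inverses\<close>

lemma bounded_bilinear_matrix_mult:
  "bounded_bilinear ((**) :: complex^'m^'n \<Rightarrow> complex^'k^'m \<Rightarrow> complex^'k^'n)"
  unfolding bilinear_conv_bounded_bilinear[symmetric] bilinear_def linear_iff
  by (auto simp: vec_eq_iff matrix_matrix_mult_def sum.distrib algebra_simps scaleR_sum_right)

interpretation matrix_mult: bounded_bilinear
  "(**) :: complex^'m^'n \<Rightarrow> complex^'k^'m \<Rightarrow> complex^'k^'n"
  by (rule bounded_bilinear_matrix_mult)

text \<open>In the Leibniz expansion at the identity matrix, a permutation other than the identity
  moves some index besides \<open>i\<close>, so the product over the indices other than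
  \<open>i\<close> still contains a zero entry. Only the identity permutation contributes, and it
  yields the trace.\<close>

lemma has_vector_derivative_det_at_one:
  fixes U :: "real \<Rightarrow> complex^'n^'n"
  assumes U: "(U has_vector_derivative U') (at t within S)" and one: "U t = mat 1"
  shows "((\<lambda>s. det (U s)) has_vector_derivative trace U') (at t within S)"
proof -
  have comp: "((\<lambda>s. U s $ i $ j) has_derivative (\<lambda>h. h *\<^sub>R U' $ i $ j)) (at t within S)" for i j
    using bounded_linear.has_vector_derivative[OF bounded_linear_vec_nth
        bounded_linear.has_vector_derivative[OF bounded_linear_vec_nth U]]
    by (simp add: has_vector_derivative_def)
  have perm: "(\<Sum>i\<in>UNIV. h *\<^sub>R U' $ i $ q i * (\<Prod>j\<in>UNIV - {i}. U t $ j $ q j)) =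
      (if q = id then h *\<^sub>R trace U' else 0)" if q: "q permutes (UNIV::'n set)" for q h
  proof (cases "q = id")
    case True
    then show ?thesis by (simp add: one mat_def trace_def scaleR_sum_right)
  next
    case False
    have z: "(\<Prod>j\<in>UNIV - {i}. U t $ j $ q j) = 0" for i
    proof -
      have "\<exists>j. j \<noteq> i \<and> q j \<noteq> j"
      proof (rule ccontr)
        assume *: "\<not> ?thesis"
        have "q i = i"
        proof (rule ccontr)
          assume "q i \<noteq> i"
          then have "q (q i) = q i" using * by blast
          then show False using \<open>q i \<noteq> i\<close> permutes_inj[OF q] by (meson injD)
        qed
        then show False using * False by (metis eq_id_iff)
      qed
      then obtain j where "j \<in> UNIV - {i}" "U t $ j $ q j = 0" by (auto simp: one mat_def)
      then show ?thesis by (intro prod_zero) auto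
    qed
    show ?thesis
      using False by (simp only: z mult_zero_right scaleR_zero_right sum.neutral_const if_False)
  qed
  have "((\<lambda>s. det (U s)) has_derivative (\<lambda>h. \<Sum>q\<in>{q. q permutes UNIV}. of_int (sign q) *
      (\<Sum>i\<in>UNIV. h *\<^sub>R U' $ i $ q i * (\<Prod>j\<in>UNIV - {i}. U t $ j $ q j)))) (at t within S)"
    unfolding det_def
    by (intro has_derivative_sum has_derivative_mult_right has_derivative_prod comp)
  also have "(\<lambda>h. \<Sum>q\<in>{q. q permutes UNIV}. of_int (sign q) *
      (\<Sum>i\<in>UNIV. h *\<^sub>R U' $ i $ q i * (\<Prod>j\<in>UNIV - {i}. U t $ j $ q j)))
      = (\<lambda>h. \<Sum>q\<in>{q. q permutes (UNIV::'n set)}. if q = id then h *\<^sub>R trace U' else 0)"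
    by (intro ext sum.cong refl) (simp only: perm mem_Collect_eq, simp add: sign_id)
  also have "\<dots> = (\<lambda>h. h *\<^sub>R trace U')"
    by (simp add: permutes_id)
  finally show ?thesis by (simp add: has_vector_derivative_def)
qed


lemma matrix_inv_mult:
  fixes A :: "complex^'n^'n"
  assumes "det A \<noteq> 0"
  shows "A ** matrix_inv A = mat 1" "matrix_inv A ** A = mat 1"
proof -
  have "\<exists>B. A ** B = mat 1 \<and> B ** A = mat 1"
    using assms unfolding invertible_det_nz[symmetric] invertible_def .
  from someI_ex[OF this] show "A ** matrix_inv A = mat 1" "matrix_inv A ** A = mat 1"
    unfolding matrix_inv_def by auto
qed

lemma matrix_inv_eqI:
  fixes A B :: "complex^'n^'n"
  assumes "A ** B = mat 1"
  shows "matrix_inv A = B"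
proof -
  have "det A * det B = 1" using assms by (metis det_I det_mul)
  then have "matrix_inv A ** A = mat 1" by (intro matrix_inv_mult) auto
  then show ?thesis using assms by (metis matrix_mul_assoc matrix_mul_lid matrix_mul_rid)
qed

lemma det_nz_of_mult_eq_one:
  fixes A B :: "complex^'n^'n"
  assumes "A ** B = mat 1"
  shows "det A \<noteq> 0" "det B \<noteq> 0"
  using assms by (metis det_I det_mul mult_zero_left mult_zero_right zero_neq_one)+

lemma det_zero_matrix: "det (0 :: complex^'n^'n) = 0"
  using det_0[where 'a = complex and 'n = 'n] by (simp only: mat_0)

lemma mat_1_neq_0: "(mat 1 :: complex^'n^'n) \<noteq> 0"
  by (metis det_I det_zero_matrix zero_neq_one)

lemma tendsto_det:
  fixes f :: "'a \<Rightarrow> complex^'n^'n"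
  assumes "(f \<longlongrightarrow> A) F"
  shows "((\<lambda>x. det (f x)) \<longlongrightarrow> det A) F"
  unfolding det_def by (intro tendsto_intros assms)

text \<open>Cramer's rule writes the entries of the inverse as quotients of determinants (the
  function \<open>G\<close>), which are continuous where the denominator does not vanish. Near the
  limit the matrices are nonsingular, so the rule applies to them as well.\<close>

lemma tendsto_matrix_inv:
  fixes f :: "'a \<Rightarrow> complex^'n^'n"
  assumes f: "(f \<longlongrightarrow> A) F" and A: "det A \<noteq> 0"
  shows "((\<lambda>x. matrix_inv (f x)) \<longlongrightarrow> matrix_inv A) F"
proof -
  define G where "G B = (\<chi> k j. det (\<chi> i l. if l = k then axis j 1 $ i else B $ i $ l) / det B)"
    for B :: "complex^'n^'n"
  have G: "matrix_inv B = G B" if "det B \<noteq> 0" for B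
  proof -
    have "matrix_inv B $ k $ j = G B $ k $ j" for k j
    proof -
      have "B *v (matrix_inv B *v axis j 1) = axis j 1"
        using that by (simp add: matrix_vector_mul_assoc matrix_inv_mult)
      then have "matrix_inv B *v axis j 1 = (\<chi> k. det (\<chi> i l. if l = k then axis j 1 $ i else B $ i $ l) / det B)"
        using cramer[OF that] by blast
      then have "(matrix_inv B *v axis j 1) $ k = G B $ k $ j"
        by (simp add: G_def)
      then show ?thesis by (simp add: matrix_vector_mult_def axis_def if_distrib cong: if_cong)
    qed
    then show ?thesis by (simp add: vec_eq_iff)
  qed
  have "((\<lambda>x. G (f x)) \<longlongrightarrow> G A) F"
    unfolding G_def
  proof (intro vec_tendstoI, simp, intro tendsto_divide tendsto_det f A)
    fix k j
    show "((\<lambda>x. \<chi> i l. if l = k then axis j 1 $ i else f x $ i $ l) \<longlongrightarrow>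
        (\<chi> i l. if l = k then axis j 1 $ i else A $ i $ l)) F"
    proof (intro vec_tendstoI)
      fix i l
      show "((\<lambda>x. (\<chi> i l. if l = k then axis j 1 $ i else f x $ i $ l) $ i $ l) \<longlongrightarrow>
        (\<chi> i l. if l = k then axis j 1 $ i else A $ i $ l) $ i $ l) F"
        by (cases "l = k") (auto intro!: tendsto_intros f)
    qed
  qed
  moreover have "eventually (\<lambda>x. G (f x) = matrix_inv (f x)) F"
    using tendsto_imp_eventually_ne[OF tendsto_det[OF f] A] by eventually_elim (simp add: G)
  ultimately show ?thesis by (simp add: G A Lim_transform_eventually)
qed

lemma has_vector_derivative_iff_slope:
  "(f has_vector_derivative D) (at t within S) \<longleftrightarrow>
    ((\<lambda>s. (f s - f t) /\<^sub>R (s - t)) \<longlongrightarrow> D) (at t within S)"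
proof -
  have "(f has_vector_derivative D) (at t within S) \<longleftrightarrow>
      ((\<lambda>s. norm (f s - f t - (s - t) *\<^sub>R D) / norm (s - t)) \<longlongrightarrow> 0) (at t within S)"
    by (simp add: has_vector_derivative_def has_derivative_iff_norm bounded_linear_scaleR_left)
  also have "\<dots> \<longleftrightarrow> ((\<lambda>s. norm ((f s - f t) /\<^sub>R (s - t) - D)) \<longlongrightarrow> 0) (at t within S)"
  proof (rule filterlim_cong)
    have "norm (f s - f t - (s - t) *\<^sub>R D) / norm (s - t) = norm ((f s - f t) /\<^sub>R (s - t) - D)"
      if "s \<noteq> t" for s
    proof -
      have "(f s - f t) /\<^sub>R (s - t) - D = (f s - f t - (s - t) *\<^sub>R D) /\<^sub>R (s - t)"
        using that by (simp add: scaleR_diff_right)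
      then show ?thesis by (simp add: divide_inverse mult.commute)
    qed
    then show "\<forall>\<^sub>F s in at t within S. norm (f s - f t - (s - t) *\<^sub>R D) / norm (s - t) =
        norm ((f s - f t) /\<^sub>R (s - t) - D)"
      by (simp add: eventually_at_filter)
  qed auto
  also have "\<dots> \<longleftrightarrow> ((\<lambda>s. (f s - f t) /\<^sub>R (s - t)) \<longlongrightarrow> D) (at t within S)"
    by (simp add: tendsto_norm_zero_iff LIM_zero_iff)
  finally show ?thesis .
qed

text \<open>With \<open>V = matrix_inv U\<close> this is the limit of the difference quotients in
  \<open>V s - V t = - V s (U s - U t) V t\<close>; the continuity of inversion takes care of the
  factor \<open>V s\<close>.\<close>

lemma has_vector_derivative_matrix_inv:
  fixes U :: "real \<Rightarrow> complex^'n^'n"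
  assumes U: "(U has_vector_derivative U') (at t within S)" and nz: "det (U t) \<noteq> 0"
  shows "((\<lambda>s. matrix_inv (U s)) has_vector_derivative - (matrix_inv (U t) ** U' ** matrix_inv (U t)))
    (at t within S)"
proof -
  let ?V = "\<lambda>s. matrix_inv (U s)"
  have lim: "(U \<longlongrightarrow> U t) (at t within S)"
    using has_vector_derivative_continuous[OF U] by (simp add: continuous_within)
  have slope: "((\<lambda>s. (U s - U t) /\<^sub>R (s - t)) \<longlongrightarrow> U') (at t within S)"
    using U unfolding has_vector_derivative_iff_slope .
  have "((\<lambda>s. - (?V s ** ((U s - U t) /\<^sub>R (s - t)) ** ?V t)) \<longlongrightarrow> - (?V t ** U' ** ?V t)) (at t within S)"
    by (intro tendsto_minus matrix_mult.tendsto tendsto_matrix_inv[OF lim nz] slope tendsto_const)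
  moreover have "eventually (\<lambda>s. - (?V s ** ((U s - U t) /\<^sub>R (s - t)) ** ?V t) = (?V s - ?V t) /\<^sub>R (s - t)) (at t within S)"
    using tendsto_imp_eventually_ne[OF tendsto_det[OF lim] nz]
  proof eventually_elim
    case (elim s)
    have "?V s ** (U s - U t) ** ?V t = ?V t - ?V s"
      using elim nz
      by (simp add: matrix_mult.diff_left matrix_mult.diff_right matrix_inv_mult flip: matrix_mul_assoc)
    then show ?case
      by (simp add: matrix_mult.scaleR_left matrix_mult.scaleR_right flip: scaleR_minus_right)
  qed
  ultimately show ?thesis
    unfolding has_vector_derivative_iff_slope by (rule Lim_transform_eventually)
qed


section \<open>Fundamental matrices and Liouville's formula\<close>

lemma fundamental_matrix_exists:
  fixes A :: "real \<Rightarrow> complex^'n^'n"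
  assumes "continuous_on {a..} A"
  obtains X where "X a = mat 1"
    and "\<And>t. a \<le> t \<Longrightarrow> (X has_vector_derivative A t ** X t) (at t within {a..})"
  using linear_ode_exists[OF bounded_bilinear_matrix_mult assms, of "mat 1"] by blast

lemma right_fundamental_matrix_exists:
  fixes A :: "real \<Rightarrow> complex^'n^'n"
  assumes "continuous_on {a..} A"
  obtains X where "X a = mat 1"
    and "\<And>t. a \<le> t \<Longrightarrow> (X has_vector_derivative X t ** A t) (at t within {a..})"
  using linear_ode_exists[OF bounded_bilinear.flip[OF bounded_bilinear_matrix_mult] assms, of "mat 1"]
  by blast

lemma constant_of_zero_derivative:
  fixes f :: "real \<Rightarrow> 'a::real_normed_vector"
  assumes "\<And>t. a \<le> t \<Longrightarrow> (f has_vector_derivative 0) (at t within {a..})" "a \<le> t"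
  shows "f t = f a"
proof -
  obtain c where "\<And>x. x \<in> {a..} \<Longrightarrow> f x = c"
    using has_vector_derivative_zero_constant[of "{a..}" f] assms by auto
  then show ?thesis using assms(2) by simp
qed

text \<open>A solution of the adjoint equation \<open>Y' = - Y A\<close> starting at the identity is
  a left inverse, because \<open>Y X\<close> has derivative zero.\<close>

lemma fundamental_matrix_det_nz:
  fixes A :: "real \<Rightarrow> complex^'n^'n"
  assumes A: "continuous_on {a..} A" and Xa: "X a = mat 1"
    and X: "\<And>t. a \<le> t \<Longrightarrow> (X has_vector_derivative A t ** X t) (at t within {a..})"
    and t: "a \<le> t"
  shows "det (X t) \<noteq> 0"
proof -
  have "continuous_on {a..} (\<lambda>t. - A t)" by (intro continuous_intros A)
  then obtain Y where Ya: "Y a = mat 1"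
    and Y: "\<And>t. a \<le> t \<Longrightarrow> (Y has_vector_derivative Y t ** - A t) (at t within {a..})"
    using right_fundamental_matrix_exists[of a "\<lambda>t. - A t"] by blast
  have "((\<lambda>t. Y t ** X t) has_vector_derivative 0) (at t within {a..})" if "a \<le> t" for t
    using matrix_mult.has_vector_derivative[OF Y[OF that] X[OF that]]
    by (simp add: matrix_mul_assoc matrix_mult.minus_left matrix_mult.minus_right)
  from constant_of_zero_derivative[OF this t] have "Y t ** X t = mat 1" by (simp add: Xa Ya)
  then show ?thesis by (rule det_nz_of_mult_eq_one)
qed

lemma right_fundamental_matrix_det_nz:
  fixes A :: "real \<Rightarrow> complex^'n^'n"
  assumes A: "continuous_on {a..} A" and Xa: "X a = mat 1"
    and X: "\<And>t. a \<le> t \<Longrightarrow> (X has_vector_derivative X t ** A t) (at t within {a..})"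
    and t: "a \<le> t"
  shows "det (X t) \<noteq> 0"
proof -
  have "continuous_on {a..} (\<lambda>t. - A t)" by (intro continuous_intros A)
  then obtain Y where Ya: "Y a = mat 1"
    and Y: "\<And>t. a \<le> t \<Longrightarrow> (Y has_vector_derivative - A t ** Y t) (at t within {a..})"
    using fundamental_matrix_exists[of a "\<lambda>t. - A t"] by blast
  have "((\<lambda>t. X t ** Y t) has_vector_derivative 0) (at t within {a..})" if "a \<le> t" for t
    using matrix_mult.has_vector_derivative[OF X[OF that] Y[OF that]]
    by (simp add: matrix_mul_assoc matrix_mult.minus_left matrix_mult.minus_right)
  from constant_of_zero_derivative[OF this t] have "X t ** Y t = mat 1" by (simp add: Xa Ya)
  then show ?thesis by (rule det_nz_of_mult_eq_one)
qed

text \<open>Liouville's formula in logarithmic form. Multiplying by \<open>matrix_inv (X t)\<close>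
  moves the point of differentiation to the identity matrix, where the derivative of the determinant
  is the trace.\<close>

lemma liouville_ln_norm_det:
  fixes A :: "complex^'n^'n" and X :: "real \<Rightarrow> complex^'n^'n"
  assumes X: "(X has_vector_derivative A ** X t) (at t within S)" and nz: "det (X t) \<noteq> 0"
  shows "((\<lambda>s. ln (cmod (det (X s)))) has_real_derivative Re (trace A)) (at t within S)"
proof -
  let ?d = "\<lambda>s. det (X s)"
  have "((\<lambda>s. X s ** matrix_inv (X t)) has_vector_derivative A ** X t ** matrix_inv (X t)) (at t within S)"
    using matrix_mult.has_vector_derivative[OF X has_vector_derivative_const, of "matrix_inv (X t)"]
    by (simp add: matrix_mult.zero_right)
  then have "((\<lambda>s. X s ** matrix_inv (X t)) has_vector_derivative A) (at t within S)"
    using nz by (simp add: matrix_inv_mult flip: matrix_mul_assoc)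
  from has_vector_derivative_det_at_one[OF this]
  have "((\<lambda>s. ?d s * det (matrix_inv (X t))) has_vector_derivative trace A) (at t within S)"
    using nz by (simp add: matrix_inv_mult det_mul)
  from has_vector_derivative_mult_left[OF this, of "?d t"]
  have "((\<lambda>s. ?d s * (det (matrix_inv (X t)) * ?d t)) has_vector_derivative trace A * ?d t) (at t within S)"
    by (simp add: mult.assoc)
  moreover have "det (matrix_inv (X t)) * ?d t = 1"
    using nz by (metis det_I det_mul matrix_inv_mult(2))
  ultimately have d: "(?d has_vector_derivative trace A * ?d t) (at t within S)" by simp
  \<comment> \<open>The logarithm of the modulus of \<open>u + i v\<close>, written as half the
    logarithm of the squared modulus so that only real derivatives occur.\<close>
  have ln2: "((\<lambda>s. ln ((u s)\<^sup>2 + (v s)\<^sup>2) / 2) has_real_derivative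
      (u t * u' + v t * v') / ((u t)\<^sup>2 + (v t)\<^sup>2)) (at t within S)"
    if "(u has_real_derivative u') (at t within S)" "(v has_real_derivative v') (at t within S)"
      and "(u t)\<^sup>2 + (v t)\<^sup>2 > 0" for u v :: "real \<Rightarrow> real" and u' v'
  proof -
    have "((\<lambda>s. (u s)\<^sup>2 + (v s)\<^sup>2) has_real_derivative 2 * (u t * u' + v t * v')) (at t within S)"
      by (auto intro!: derivative_eq_intros that(1,2))
    from DERIV_cdivide[OF DERIV_chain2[OF DERIV_ln_divide[OF that(3)] this], of 2]
    moreover have "1 / w * (2 * x) / 2 = x / w" for w x :: real by simp
    ultimately show ?thesis by metis
  qed
  have pos: "(Re (?d t))\<^sup>2 + (Im (?d t))\<^sup>2 > 0"
    using nz by (metis cmod_power2 zero_less_norm_iff zero_less_power)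
  have d1: "((\<lambda>s. ln ((Re (?d s))\<^sup>2 + (Im (?d s))\<^sup>2) / 2) has_real_derivative
      (Re (?d t) * Re (trace A * ?d t) + Im (?d t) * Im (trace A * ?d t)) /
        ((Re (?d t))\<^sup>2 + (Im (?d t))\<^sup>2)) (at t within S)"
    using bounded_linear.has_vector_derivative[OF bounded_linear_Re d]
      bounded_linear.has_vector_derivative[OF bounded_linear_Im d] pos
    by (intro ln2) (simp_all add: has_real_derivative_iff_has_vector_derivative)
  have e1: "(Re (?d t) * Re (trace A * ?d t) + Im (?d t) * Im (trace A * ?d t)) /
        ((Re (?d t))\<^sup>2 + (Im (?d t))\<^sup>2) = Re (trace A)"
    using pos by (simp add: divide_simps) (auto simp: algebra_simps power2_eq_square)
  have e2: "ln (cmod z) = ln ((Re z)\<^sup>2 + (Im z)\<^sup>2) / 2" for z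
    by (simp add: cmod_def ln_sqrt)
  show ?thesis using d1 unfolding e1 e2 .
qed

section \<open>Comparison of matrix norms\<close>

text \<open>Expansion in a basis shows that \<open>N\<close> is Lipschitz, so it attains a minimum
  on the compact unit sphere; definiteness makes the minimum positive and homogeneity extends the
  bound to all matrices. Divergence thereby passes from \<open>norm\<close> to an arbitrary
  \<open>N\<close>.\<close>

lemma matrix_norm_ge:
  fixes N :: "complex^'n^'n \<Rightarrow> real"
  assumes N: "is_matrix_norm N"
  obtains c where "c > 0" "\<And>A. c * norm A \<le> N A"
proof -
  have pos: "N A \<ge> 0" and zero: "N A = 0 \<longleftrightarrow> A = 0" and tri: "N (A + B) \<le> N A + N B"
    and hom: "N (\<chi> i j. z * A $ i $ j) = cmod z * N A" for A B z
    using N unfolding is_matrix_norm_def by auto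
  have scal: "N (r *\<^sub>R A) = \<bar>r\<bar> * N A" for r A
  proof -
    have "r *\<^sub>R A = (\<chi> i j. of_real r * A $ i $ j)"
      by (simp add: vec_eq_iff scaleR_conv_of_real[where 'a=complex])
    then show ?thesis by (simp add: hom)
  qed
  have sum_le: "N (\<Sum>b\<in>S. f b) \<le> (\<Sum>b\<in>S. N (f b))" if "finite S" for S and f :: "complex^'n^'n \<Rightarrow> complex^'n^'n"
    using that
  proof induction
    case (insert x F)
    then show ?case using tri[of "f x" "sum f F"] by simp
  qed (use zero[of 0] in simp)
  define L where "L = (\<Sum>b\<in>(Basis :: (complex^'n^'n) set). N b)"
  have up: "N A \<le> L * norm A" for A
  proof -
    have "N A = N (\<Sum>b\<in>Basis. (A \<bullet> b) *\<^sub>R b)" by (simp add: euclidean_representation)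
    also have "\<dots> \<le> (\<Sum>b\<in>Basis. \<bar>A \<bullet> b\<bar> * N b)"
      using sum_le[OF finite_Basis, of "\<lambda>b. (A \<bullet> b) *\<^sub>R b"] by (simp add: scal)
    also have "\<dots> \<le> (\<Sum>b\<in>Basis. norm A * N b)"
      by (intro sum_mono mult_right_mono Basis_le_norm pos)
    finally show ?thesis by (simp add: L_def sum_distrib_left mult.commute)
  qed
  have "L \<ge> 0" unfolding L_def by (intro sum_nonneg pos)
  have lip: "\<bar>N A - N B\<bar> \<le> L * norm (A - B)" for A B
    using tri[of "A - B" B] tri[of "B - A" A] up[of "A - B"] up[of "B - A"]
    by (simp add: norm_minus_commute)
  have "L-lipschitz_on UNIV N"
    using lip \<open>L \<ge> 0\<close> by (intro lipschitz_onI) (auto simp: dist_norm dist_real_def)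
  then have cont: "continuous_on (sphere 0 1) N"
    using lipschitz_on_continuous_on continuous_on_subset by blast
  have "sphere (0::complex^'n^'n) 1 \<noteq> {}" by simp
  with continuous_attains_inf[OF compact_sphere _ cont] obtain A0
    where A0: "A0 \<in> sphere 0 1" "\<And>A. A \<in> sphere 0 1 \<Longrightarrow> N A0 \<le> N A" by blast
  show thesis
  proof
    show "N A0 > 0" using A0(1) pos[of A0] zero[of A0] by (auto simp: less_le)
    fix A
    show "N A0 * norm A \<le> N A"
    proof (cases "A = 0")
      case False
      have "N A0 \<le> N (A /\<^sub>R norm A)" using False by (intro A0) simp
      then show ?thesis using False by (simp add: scal field_simps)
    qed (simp add: pos)
  qed
qed

section \<open>The matrix Riccati equation\<close>

lemmas matrix_ring_simps = matrix_mul_assoc matrix_mult.add_left matrix_mult.add_right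
  matrix_mult.diff_left matrix_mult.diff_right matrix_mult.minus_left matrix_mult.minus_right

text \<open>Cancellation adapted to the left-associated products produced by
  \<open>matrix_mul_assoc\<close>, where \<open>A\<close> and its inverse are adjacent but do not
  form a subterm.\<close>

lemma matrix_inv_cancel_right:
  fixes A :: "complex^'n^'n"
  assumes "det A \<noteq> 0"
  shows "B ** A ** matrix_inv A = B" "B ** matrix_inv A ** A = B"
  using matrix_inv_mult[OF assms] by (simp_all flip: matrix_mul_assoc)

lemma riccati_solution_on_cong:
  assumes "riccati_solution_on P Q R S t0 I Z" "\<And>t. t \<in> I \<Longrightarrow> W t = Z t"
  shows "riccati_solution_on P Q R S t0 I W"
  unfolding riccati_solution_on_def
proof (intro conjI ballI)
  fix t assume t: "t \<in> I"
  then obtain Z' where Z': "(Z has_vector_derivative Z') (at t within I)"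
      "Z' + Z t ** P t ** Z t + Q t ** Z t + Z t ** R t + S t = 0"
    using assms(1) unfolding riccati_solution_on_def by blast
  have "(W has_vector_derivative Z') (at t within I)"
    by (rule has_vector_derivative_transform[OF t _ Z'(1)]) (simp add: assms(2))
  then show "\<exists>W'. (W has_vector_derivative W') (at t within I) \<and>
      W' + W t ** P t ** W t + Q t ** W t + W t ** R t + S t = 0"
    using Z'(2) assms(2)[OF t] by auto
qed (use assms(1) in \<open>auto simp: riccati_solution_on_def\<close>)

lemma riccati_regular_has_derivative:
  assumes "riccati_regular P Q R S t0 t1 Z" "t1 \<le> t"
  shows "(Z has_vector_derivative - (Z t ** P t ** Z t + Q t ** Z t + Z t ** R t + S t))
    (at t within {t1..})"
proof -
  obtain Z' where "(Z has_vector_derivative Z') (at t within {t1..})"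
      "Z' + Z t ** P t ** Z t + Q t ** Z t + Z t ** R t + S t = 0"
    using assms unfolding riccati_regular_def riccati_solution_on_def by auto
  moreover from this(2) have "Z' = - (Z t ** P t ** Z t + Q t ** Z t + Z t ** R t + S t)"
    unfolding eq_neg_iff_add_eq_0 by (simp only: add.assoc)
  ultimately show ?thesis by simp
qed

section \<open>Linear equations along regular solutions\<close>

locale riccati_equation =
  fixes P Q R S :: "real \<Rightarrow> complex^'n^'n" and t0 t1 :: real
  assumes cont: "continuous_on {t0..} P" "continuous_on {t0..} Q" "continuous_on {t0..} R"
    and t0_le: "t0 \<le> t1"
begin

abbreviation "regular \<equiv> riccati_regular P Q R S t0 t1"
abbreviation "\<Phi> \<equiv> Phi_sol P R t1"
abbreviation "\<Psi> \<equiv> Psi_sol P Q t1"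

lemma cont': "continuous_on {t1..} P" "continuous_on {t1..} Q" "continuous_on {t1..} R"
  using cont t0_le by (auto elim!: continuous_on_subset)

lemma continuous_on_regular:
  assumes "regular Z"
  shows "continuous_on {t1..} Z"
  unfolding continuous_on_eq_continuous_within
  using has_vector_derivative_continuous[OF riccati_regular_has_derivative[OF assms]] by auto

lemma continuous_on_coefficients:
  assumes "regular Z"
  shows "continuous_on {t1..} (\<lambda>t. P t ** Z t + R t)" "continuous_on {t1..} (\<lambda>t. Z t ** P t + Q t)"
  by (intro continuous_intros matrix_mult.continuous_on cont' continuous_on_regular assms)+

lemma Phi_sol_props:
  assumes "regular Z"
  shows "\<Phi> Z t1 = mat 1"
    and "t1 \<le> t \<Longrightarrow> (\<Phi> Z has_vector_derivative (P t ** Z t + R t) ** \<Phi> Z t) (at t within {t1..})"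
proof -
  have "\<exists>X. X t1 = mat 1 \<and>
      (\<forall>t\<ge>t1. (X has_vector_derivative (P t ** Z t + R t) ** X t) (at t within {t1..}))"
    using fundamental_matrix_exists[OF continuous_on_coefficients(1)[OF assms]] by blast
  from someI_ex[OF this] show "\<Phi> Z t1 = mat 1"
    and "t1 \<le> t \<Longrightarrow> (\<Phi> Z has_vector_derivative (P t ** Z t + R t) ** \<Phi> Z t) (at t within {t1..})"
    unfolding Phi_sol_def by blast+
qed

lemma Psi_sol_props:
  assumes "regular Z"
  shows "\<Psi> Z t1 = mat 1"
    and "t1 \<le> t \<Longrightarrow> (\<Psi> Z has_vector_derivative \<Psi> Z t ** (Z t ** P t + Q t)) (at t within {t1..})"
proof -
  have "\<exists>X. X t1 = mat 1 \<and>
      (\<forall>t\<ge>t1. (X has_vector_derivative X t ** (Z t ** P t + Q t)) (at t within {t1..}))"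
    using right_fundamental_matrix_exists[OF continuous_on_coefficients(2)[OF assms]] by blast
  from someI_ex[OF this] show "\<Psi> Z t1 = mat 1"
    and "t1 \<le> t \<Longrightarrow> (\<Psi> Z has_vector_derivative \<Psi> Z t ** (Z t ** P t + Q t)) (at t within {t1..})"
    unfolding Psi_sol_def by blast+
qed

lemma det_Phi_nz: "regular Z \<Longrightarrow> t1 \<le> t \<Longrightarrow> det (\<Phi> Z t) \<noteq> 0"
  by (rule fundamental_matrix_det_nz[OF continuous_on_coefficients(1) Phi_sol_props])

lemma det_Psi_nz: "regular Z \<Longrightarrow> t1 \<le> t \<Longrightarrow> det (\<Psi> Z t) \<noteq> 0"
  by (rule right_fundamental_matrix_det_nz[OF continuous_on_coefficients(2) Psi_sol_props])

text \<open>The difference \<open>D = Z - W\<close> satisfies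
  \<open>D' = - (W P + Q) D - D (P Z + R)\<close>. The two coefficients are those of
  \<open>\<Psi> W\<close> and \<open>\<Phi> Z\<close>, so all terms of the product rule
  cancel.\<close>

lemma Psi_diff_Phi_constant:
  assumes Z: "regular Z" and W: "regular W" and t: "t1 \<le> t"
  shows "\<Psi> W t ** (Z t - W t) ** \<Phi> Z t = Z t1 - W t1"
proof -
  have "((\<lambda>t. \<Psi> W t ** (Z t - W t) ** \<Phi> Z t) has_vector_derivative 0) (at t within {t1..})"
    if t: "t1 \<le> t" for t
    using matrix_mult.has_vector_derivative[OF matrix_mult.has_vector_derivative[OF Psi_sol_props(2)[OF W t]
          has_vector_derivative_diff[OF riccati_regular_has_derivative[OF Z t]
            riccati_regular_has_derivative[OF W t]]] Phi_sol_props(2)[OF Z t]]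
    by (rule has_vector_derivative_eq_rhs) (simp add: matrix_ring_simps)
  from constant_of_zero_derivative[OF this t] show ?thesis
    using Z W by (simp add: Phi_sol_props Psi_sol_props)
qed

end

section \<open>Solutions expressed through a reference solution\<close>

locale riccati_reference = riccati_equation P Q R S t0 t1
  for P Q R S :: "real \<Rightarrow> complex^'n^'n" and t0 t1 :: real +
  fixes Z0 :: "real \<Rightarrow> complex^'n^'n"
  assumes reg0: "regular Z0"
begin

definition "K t = matrix_inv (\<Phi> Z0 t) ** P t ** matrix_inv (\<Psi> Z0 t)"
definition "M t = integral {t1..t} K"

lemma inv_Phi_has_derivative:
  assumes "t1 \<le> t"
  shows "((\<lambda>t. matrix_inv (\<Phi> Z0 t)) has_vector_derivative
    - (matrix_inv (\<Phi> Z0 t) ** (P t ** Z0 t + R t))) (at t within {t1..})"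
  using has_vector_derivative_matrix_inv[OF Phi_sol_props(2)[OF reg0 assms] det_Phi_nz[OF reg0 assms]]
  by (simp add: matrix_mul_assoc matrix_inv_cancel_right det_Phi_nz[OF reg0 assms])

lemma inv_Psi_has_derivative:
  assumes "t1 \<le> t"
  shows "((\<lambda>t. matrix_inv (\<Psi> Z0 t)) has_vector_derivative
    - ((Z0 t ** P t + Q t) ** matrix_inv (\<Psi> Z0 t))) (at t within {t1..})"
  using has_vector_derivative_matrix_inv[OF Psi_sol_props(2)[OF reg0 assms] det_Psi_nz[OF reg0 assms]]
  by (simp add: matrix_mul_assoc matrix_inv_mult det_Psi_nz[OF reg0 assms])

lemma continuous_on_K: "continuous_on {t1..} K"
proof -
  have "continuous_on {t1..} (\<lambda>t. matrix_inv (\<Phi> Z0 t))" "continuous_on {t1..} (\<lambda>t. matrix_inv (\<Psi> Z0 t))"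
    unfolding continuous_on_eq_continuous_within
    using has_vector_derivative_continuous[OF inv_Phi_has_derivative]
      has_vector_derivative_continuous[OF inv_Psi_has_derivative] by auto
  then show ?thesis
    unfolding K_def by (intro matrix_mult.continuous_on cont')
qed

lemma K_integrable: "t1 \<le> s \<Longrightarrow> K integrable_on {s..t}"
  by (rule integrable_continuous_real, rule continuous_on_subset[OF continuous_on_K]) auto

lemma M_t1: "M t1 = 0"
  by (simp add: M_def)

lemma M_has_derivative:
  assumes t: "t1 \<le> t"
  shows "(M has_vector_derivative K t) (at t within {t1..})"
proof -
  have "(M has_vector_derivative K t) (at t within {t1..t+1})"
    unfolding M_def[abs_def]
    by (rule integral_has_vector_derivative, rule continuous_on_subset[OF continuous_on_K]) (use t in auto)
  also have "at t within {t1..t+1} = at t within {t1..}"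
    by (rule at_within_nhd[of _ "{..<t+1}"]) auto
  finally show ?thesis .
qed

lemma one_plus_M_has_derivative:
  assumes t: "t1 \<le> t"
  shows "((\<lambda>t. mat 1 + M t ** \<Lambda>) has_vector_derivative K t ** \<Lambda>) (at t within {t1..})"
  using has_vector_derivative_add[OF has_vector_derivative_const
      matrix_mult.has_vector_derivative[OF M_has_derivative[OF t] has_vector_derivative_const]]
  by (simp add: matrix_mult.zero_right)

text \<open>By \<open>Psi_diff_Phi_constant\<close>, the quotient \<open>F\<close> of the two
  fundamental matrices has derivative \<open>K t ** ?L\<close> with a constant \<open>?L\<close>,
  and \<open>M\<close> is the integral of \<open>K\<close>. Thus the fundamental matrix of any
  regular solution is determined by its initial value.\<close>

lemma Phi_sol_regular:
  assumes Z: "regular Z" and t: "t1 \<le> t"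
  shows "\<Phi> Z t = \<Phi> Z0 t ** (mat 1 + M t ** (Z t1 - Z0 t1))"
proof -
  let ?L = "Z t1 - Z0 t1"
  define F where "F t = matrix_inv (\<Phi> Z0 t) ** \<Phi> Z t" for t
  have F: "(F has_vector_derivative K t ** ?L) (at t within {t1..})" if t: "t1 \<le> t" for t
  proof -
    have "(Z t - Z0 t) ** \<Phi> Z t = matrix_inv (\<Psi> Z0 t) ** ?L"
      unfolding Psi_diff_Phi_constant[OF Z reg0 t, symmetric]
      by (simp add: matrix_mul_assoc matrix_inv_mult det_Psi_nz[OF reg0 t])
    then have "K t ** ?L = matrix_inv (\<Phi> Z0 t) ** P t ** (Z t - Z0 t) ** \<Phi> Z t"
      unfolding K_def by (simp flip: matrix_mul_assoc)
    with matrix_mult.has_vector_derivative[OF inv_Phi_has_derivative[OF t] Phi_sol_props(2)[OF Z t]]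
    show ?thesis
      unfolding F_def by (simp add: matrix_ring_simps)
  qed
  have "((\<lambda>t. F t - (mat 1 + M t ** ?L)) has_vector_derivative 0) (at t within {t1..})" if "t1 \<le> t" for t
    using has_vector_derivative_diff[OF F one_plus_M_has_derivative[of _ ?L], OF that that] by simp
  from constant_of_zero_derivative[OF this t]
  have "F t = mat 1 + M t ** ?L"
    using matrix_inv_mult[of "mat 1 :: complex^'n^'n"]
    by (simp add: F_def Phi_sol_props Z reg0 M_t1 matrix_mult.zero_left diff_eq_eq)
  then have "\<Phi> Z0 t ** F t = \<Phi> Z0 t ** (mat 1 + M t ** ?L)" by simp
  then show ?thesis
    by (simp add: F_def matrix_mul_assoc matrix_inv_mult det_Phi_nz[OF reg0 t])
qed

text \<open>The mirror image of \<open>Phi_sol_regular\<close>, with the two solutions exchanged in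
  \<open>Psi_diff_Phi_constant\<close>.\<close>

lemma Psi_sol_regular:
  assumes Z: "regular Z" and t: "t1 \<le> t"
  shows "\<Psi> Z t = (mat 1 + (Z t1 - Z0 t1) ** M t) ** \<Psi> Z0 t"
proof -
  let ?L = "Z t1 - Z0 t1"
  define G where "G t = \<Psi> Z t ** matrix_inv (\<Psi> Z0 t)" for t
  have G: "(G has_vector_derivative ?L ** K t) (at t within {t1..})" if t: "t1 \<le> t" for t
  proof -
    have "?L = \<Psi> Z t ** (Z t - Z0 t) ** \<Phi> Z0 t"
      using Psi_diff_Phi_constant[OF reg0 Z t] by (simp add: matrix_ring_simps algebra_simps)
    then have "?L ** matrix_inv (\<Phi> Z0 t) = \<Psi> Z t ** (Z t - Z0 t)"
      by (simp add: matrix_inv_cancel_right det_Phi_nz[OF reg0 t])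
    then have "?L ** K t = \<Psi> Z t ** (Z t - Z0 t) ** P t ** matrix_inv (\<Psi> Z0 t)"
      unfolding K_def by (simp add: matrix_mul_assoc)
    with matrix_mult.has_vector_derivative[OF Psi_sol_props(2)[OF Z t] inv_Psi_has_derivative[OF t]]
    show ?thesis
      unfolding G_def by (simp add: matrix_ring_simps)
  qed
  have "((\<lambda>t. G t - (mat 1 + ?L ** M t)) has_vector_derivative 0) (at t within {t1..})" if "t1 \<le> t" for t
    using has_vector_derivative_diff[OF G has_vector_derivative_add[OF has_vector_derivative_const
      matrix_mult.has_vector_derivative[OF has_vector_derivative_const[of ?L] M_has_derivative]], OF that that]
    by (simp add: matrix_mult.zero_left)
  from constant_of_zero_derivative[OF this t]
  have "G t = mat 1 + ?L ** M t"
    using matrix_inv_mult[of "mat 1 :: complex^'n^'n"]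
    by (simp add: G_def Psi_sol_props Z reg0 M_t1 matrix_mult.zero_right diff_eq_eq)
  then have "G t ** \<Psi> Z0 t = (mat 1 + ?L ** M t) ** \<Psi> Z0 t" by simp
  then show ?thesis
    by (simp add: G_def matrix_inv_cancel_right det_Psi_nz[OF reg0 t])
qed

text \<open>The necessary half of the regularity criterion; \<open>riccati_solution_from\<close>
  supplies the sufficient half.\<close>

lemma det_one_plus_M_nz:
  assumes "regular Z" "t1 \<le> t"
  shows "det (mat 1 + M t ** (Z t1 - Z0 t1)) \<noteq> 0"
  using det_Phi_nz[OF assms] by (simp add: Phi_sol_regular[OF assms] det_mul)

text \<open>The formula results from solving \<open>Psi_diff_Phi_constant\<close> for the difference
  to \<open>Z0\<close> and inserting \<open>Phi_sol_regular\<close>.\<close>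

definition "solution_from \<Lambda> t =
  Z0 t + matrix_inv (\<Psi> Z0 t) ** \<Lambda> ** matrix_inv (mat 1 + M t ** \<Lambda>) ** matrix_inv (\<Phi> Z0 t)"

lemma solution_from_t1: "solution_from \<Lambda> t1 = Z0 t1 + \<Lambda>"
  using matrix_inv_mult[of "mat 1 :: complex^'n^'n"]
  by (simp add: solution_from_def M_t1 matrix_mult.zero_left Phi_sol_props Psi_sol_props reg0)

text \<open>Let \<open>Y\<close> be the difference to \<open>Z0\<close>. Differentiating the outer
  factors of \<open>Y\<close> gives the terms linear in \<open>Y\<close>, and differentiating the
  inverse of \<open>1 + M \<Lambda>\<close> gives \<open>- Y P Y\<close>, because \<open>K\<close>
  contains exactly the outer factors around \<open>P\<close>. The interval \<open>J\<close> is
  arbitrary so that merely local solutions are covered.\<close>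

lemma riccati_solution_from:
  assumes J: "is_interval J" "interior J \<noteq> {}" "J \<subseteq> {t1..}"
    and nz: "\<And>t. t \<in> J \<Longrightarrow> det (mat 1 + M t ** \<Lambda>) \<noteq> 0"
  shows "riccati_solution_on P Q R S t0 J (solution_from \<Lambda>)"
  unfolding riccati_solution_on_def
proof (intro conjI ballI)
  fix t assume t: "t \<in> J"
  then have t': "t1 \<le> t" using J by auto
  let ?Y = "matrix_inv (\<Psi> Z0 t) ** \<Lambda> ** matrix_inv (mat 1 + M t ** \<Lambda>) ** matrix_inv (\<Phi> Z0 t)"
  let ?D = "- (Z0 t ** P t ** Z0 t + Q t ** Z0 t + Z0 t ** R t + S t)
      - (Z0 t ** P t + Q t) ** ?Y - ?Y ** (P t ** Z0 t + R t) - ?Y ** P t ** ?Y"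
  note d1 = matrix_mult.has_vector_derivative[OF inv_Psi_has_derivative[OF t'] has_vector_derivative_const, of \<Lambda>]
  note d2 = has_vector_derivative_matrix_inv[OF one_plus_M_has_derivative[OF t'] nz[OF t]]
  note d3 = matrix_mult.has_vector_derivative[OF matrix_mult.has_vector_derivative[OF d1 d2] inv_Phi_has_derivative[OF t']]
  have "(solution_from \<Lambda> has_vector_derivative ?D) (at t within {t1..})"
    unfolding solution_from_def[abs_def]
    using has_vector_derivative_add[OF riccati_regular_has_derivative[OF reg0 t'] d3]
    by (rule has_vector_derivative_eq_rhs)
       (simp add: matrix_ring_simps matrix_mult.zero_right K_def)
  then have "(solution_from \<Lambda> has_vector_derivative ?D) (at t within J)"
    by (rule has_vector_derivative_within_subset) (rule J)
  moreover have "?D + solution_from \<Lambda> t ** P t ** solution_from \<Lambda> t + Q t ** solution_from \<Lambda> t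
      + solution_from \<Lambda> t ** R t + S t = 0"
    unfolding solution_from_def by (simp add: matrix_ring_simps)
  ultimately show "\<exists>W'. (solution_from \<Lambda> has_vector_derivative W') (at t within J) \<and>
      W' + solution_from \<Lambda> t ** P t ** solution_from \<Lambda> t + Q t ** solution_from \<Lambda> t
      + solution_from \<Lambda> t ** R t + S t = 0"
    by blast
qed (use J t0_le in auto)

end

context riccati_reference
begin

lemma nu_partial_eq:
  assumes "t1 \<le> t" "t \<le> T"
  shows "nu_partial P Q R t1 Z0 t T = M T - M t"
proof -
  have "nu_partial P Q R t1 Z0 t T = integral {t..T} K"
    by (simp add: nu_partial_def K_def[abs_def])
  moreover have "integral {t1..t} K + integral {t..T} K = integral {t1..T} K"
    using assms by (intro Henstock_Kurzweil_Integration.integral_combine K_integrable) auto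
  ultimately show ?thesis by (simp add: M_def algebra_simps)
qed

end

section \<open>Convergence of the integral and a necessary condition for normality\<close>

locale riccati_nu = riccati_reference P Q R S t0 t1 Z0
  for P Q R S :: "real \<Rightarrow> complex^'n^'n" and t0 t1 :: real and Z0 :: "real \<Rightarrow> complex^'n^'n" +
  assumes conv: "nu_convergent P Q R t1 Z0 t1"
    and det_nu_nz: "t1 \<le> t \<Longrightarrow> det (nu P Q R t1 Z0 t) \<noteq> 0"
begin

abbreviation "\<nu> \<equiv> nu P Q R t1 Z0"
abbreviation "N \<equiv> \<nu> t1"

text \<open>Convergence is given for the starting point \<open>t1\<close> only, where the partial
  integrals are \<open>M\<close>. A later starting point \<open>t\<close> merely subtracts the
  constant \<open>M t\<close>.\<close>

lemma nu_eq_limit_diff: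
  "\<exists>L. (M \<longlongrightarrow> L) at_top \<and> (\<forall>t\<ge>t1. \<nu> t = L - M t)"
proof -
  from conv obtain L where "(nu_partial P Q R t1 Z0 t1 \<longlongrightarrow> L) at_top"
    unfolding nu_convergent_def by blast
  moreover have "nu_partial P Q R t1 Z0 t1 = M"
    by (simp add: nu_partial_def M_def K_def[abs_def] fun_eq_iff)
  ultimately have L: "(M \<longlongrightarrow> L) at_top" by simp
  moreover have "\<nu> t = L - M t" if t: "t1 \<le> t" for t
  proof -
    have "((\<lambda>T. M T - M t) \<longlongrightarrow> L - M t) at_top" by (intro tendsto_intros L)
    moreover have "eventually (\<lambda>T. M T - M t = nu_partial P Q R t1 Z0 t T) at_top"
      using eventually_ge_at_top[of t] by eventually_elim (simp add: nu_partial_eq t)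
    ultimately have "(nu_partial P Q R t1 Z0 t \<longlongrightarrow> L - M t) at_top"
      by (rule Lim_transform_eventually)
    then show ?thesis unfolding nu_def by (intro tendsto_Lim) auto
  qed
  ultimately show ?thesis by blast
qed

lemma nu_eq: "t1 \<le> t \<Longrightarrow> \<nu> t = N - M t"
  and M_tendsto: "(M \<longlongrightarrow> N) at_top"
  using nu_eq_limit_diff by (auto simp: M_t1)

lemma det_N_nz: "det N \<noteq> 0"
  by (simp add: det_nu_nz)

lemma nu_tendsto: "(\<nu> \<longlongrightarrow> 0) at_top"
proof -
  have "((\<lambda>t. N - M t) \<longlongrightarrow> N - N) at_top" by (intro tendsto_intros M_tendsto)
  moreover have "eventually (\<lambda>t. N - M t = \<nu> t) at_top"
    using eventually_ge_at_top[of t1] by eventually_elim (rule nu_eq[symmetric])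
  ultimately show ?thesis by (simp add: Lim_transform_eventually)
qed

lemma nu_has_derivative:
  assumes "t1 \<le> t"
  shows "(\<nu> has_vector_derivative - K t) (at t within {t1..})"
proof -
  have "((\<lambda>t. N - M t) has_vector_derivative - K t) (at t within {t1..})"
    using has_vector_derivative_diff[OF has_vector_derivative_const M_has_derivative[OF assms], of N] by simp
  then show ?thesis
    by (rule has_vector_derivative_transform[rotated 2]) (simp_all add: assms flip: nu_eq)
qed

text \<open>If \<open>\<Lambda> + N\<^sup>-\<^sup>1\<close> were singular, the initial values \<open>\<Lambda> + N\<^sup>-\<^sup>1 - M(t)\<^sup>-\<^sup>1\<close>, which tend to
  \<open>\<Lambda>\<close>, would blow up at or before \<open>t\<close>, because \<open>1 + M(t) (\<Lambda> + N\<^sup>-\<^sup>1 - M(t)\<^sup>-\<^sup>1) = M(t) (\<Lambda> + N\<^sup>-\<^sup>1)\<close>.\<close>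

lemma det_normal_nz:
  assumes normal: "riccati_normal P Q R S t0 t1 Z"
  shows "det (Z t1 - Z0 t1 + matrix_inv N) \<noteq> 0"
proof
  assume sing: "det (Z t1 - Z0 t1 + matrix_inv N) = 0"
  obtain U where U: "open U" "Z t1 \<in> U"
    "\<And>I W. riccati_solution_on P Q R S t0 I W \<Longrightarrow> t1 \<in> I \<Longrightarrow> W t1 \<in> U \<Longrightarrow>
      \<exists>V. riccati_solution_on P Q R S t0 (I \<union> {t1..}) V \<and> (\<forall>t\<in>I. V t = W t)"
    using normal unfolding riccati_normal_def by blast
  define L where "L t = Z t1 - Z0 t1 + matrix_inv N - matrix_inv (M t)" for t
  have "((\<lambda>t. Z0 t1 + L t) \<longlongrightarrow> Z0 t1 + (Z t1 - Z0 t1 + matrix_inv N - matrix_inv N)) at_top"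
    unfolding L_def by (intro tendsto_intros tendsto_matrix_inv M_tendsto det_N_nz)
  then have "((\<lambda>t. Z0 t1 + L t) \<longlongrightarrow> Z t1) at_top" by simp
  from topological_tendstoD[OF this U(1,2)]
  have ev: "eventually (\<lambda>t. Z0 t1 + L t \<in> U) at_top" .
  have "eventually (\<lambda>t. det (M t) \<noteq> 0) at_top"
    by (rule tendsto_imp_eventually_ne[OF tendsto_det[OF M_tendsto] det_N_nz])
  with ev eventually_ge_at_top[of t1]
  have "eventually (\<lambda>t. Z0 t1 + L t \<in> U \<and> det (M t) \<noteq> 0 \<and> t1 \<le> t) at_top"
    by eventually_elim auto
  then obtain t where t: "Z0 t1 + L t \<in> U" "det (M t) \<noteq> 0" "t1 \<le> t"
    unfolding eventually_at_top_linorder by blast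
  \<comment> \<open>A local solution needs a nondegenerate interval. At \<open>t1\<close> the matrix
    \<open>mat 1 + M u ** L t\<close> is the identity, so by continuity it stays nonsingular on some
    \<open>{t1..t1 + d/2}\<close>.\<close>
  have "((\<lambda>u. mat 1 + M u ** L t) \<longlongrightarrow> mat 1 + M t1 ** L t) (at t1 within {t1..})"
    using has_vector_derivative_continuous[OF one_plus_M_has_derivative[of t1 "L t"]]
    by (simp add: continuous_within)
  from tendsto_imp_eventually_ne[OF tendsto_det[OF this], of 0]
  have "eventually (\<lambda>u. det (mat 1 + M u ** L t) \<noteq> 0) (at t1 within {t1..})"
    by (simp add: M_t1 matrix_mult.zero_left)
  then obtain d where d: "d > 0" "\<And>u. u \<ge> t1 \<Longrightarrow> u \<noteq> t1 \<Longrightarrow> dist u t1 < d \<Longrightarrow> det (mat 1 + M u ** L t) \<noteq> 0"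
    unfolding eventually_at by auto
  have nz: "det (mat 1 + M u ** L t) \<noteq> 0" if "u \<in> {t1..t1 + d/2}" for u
    using that d by (cases "u = t1") (auto simp: M_t1 matrix_mult.zero_left dist_real_def)
  have "riccati_solution_on P Q R S t0 {t1..t1 + d/2} (solution_from (L t))"
    using d(1) by (intro riccati_solution_from nz) (auto simp: is_interval_cc)
  from U(3)[OF this] obtain V where V: "riccati_solution_on P Q R S t0 ({t1..t1 + d/2} \<union> {t1..}) V"
      "\<And>u. u \<in> {t1..t1 + d/2} \<Longrightarrow> V u = solution_from (L t) u"
    using t(1) d(1) by (auto simp: solution_from_t1)
  have "{t1..t1 + d/2} \<union> {t1..} = {t1..}" by auto
  with V(1) have "regular V" by (simp add: riccati_regular_def)
  moreover have "V t1 - Z0 t1 = L t" using V(2)[of t1] d(1) by (simp add: solution_from_t1)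
  ultimately have "det (mat 1 + M t ** L t) \<noteq> 0" using det_one_plus_M_nz[of V t] t(3) by simp
  moreover have "mat 1 + M t ** L t = M t ** (Z t1 - Z0 t1 + matrix_inv N)"
    using t(2) by (simp add: L_def matrix_mult.diff_right matrix_inv_mult matrix_mult.add_right)
  ultimately show False using sing by (simp add: det_mul)
qed

section \<open>The extremal solution\<close>

definition "Zs t = Z0 t - matrix_inv (\<Phi> Z0 t ** \<nu> t ** \<Psi> Z0 t)"

lemma one_plus_M_Zs:
  assumes "t1 \<le> t"
  shows "mat 1 + M t ** - matrix_inv N = \<nu> t ** matrix_inv N"
    "mat 1 + - matrix_inv N ** M t = matrix_inv N ** \<nu> t"
  using det_N_nz nu_eq[OF assms] by (simp_all add: matrix_ring_simps matrix_inv_mult)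

text \<open>The closed form agrees with the general formula because the factor \<open>N\<close> in
  the inverse of \<open>\<nu> t ** matrix_inv N\<close> cancels against
  \<open>\<Lambda> = - matrix_inv N\<close>.\<close>

lemma Zs_eq:
  assumes t: "t1 \<le> t"
  shows "Zs t = solution_from (- matrix_inv N) t"
proof -
  note nz = det_Phi_nz[OF reg0 t] det_Psi_nz[OF reg0 t] det_nu_nz[OF t] det_N_nz
  have "matrix_inv (\<nu> t ** matrix_inv N) = N ** matrix_inv (\<nu> t)"
    using nz by (intro matrix_inv_eqI) (simp add: matrix_mul_assoc matrix_inv_cancel_right matrix_inv_mult)
  moreover have "matrix_inv (\<Phi> Z0 t ** \<nu> t ** \<Psi> Z0 t)
      = matrix_inv (\<Psi> Z0 t) ** matrix_inv (\<nu> t) ** matrix_inv (\<Phi> Z0 t)"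
    using nz by (intro matrix_inv_eqI) (simp add: matrix_mul_assoc matrix_inv_cancel_right matrix_inv_mult)
  ultimately show ?thesis
    unfolding Zs_def solution_from_def one_plus_M_Zs(1)[OF t]
    using nz by (simp add: matrix_ring_simps matrix_inv_cancel_right)
qed

lemma Zs_t1: "Zs t1 - Z0 t1 = - matrix_inv N"
  by (simp add: Zs_eq solution_from_t1)

lemma regular_Zs: "regular Zs"
proof -
  have "riccati_solution_on P Q R S t0 {t1..} (solution_from (- matrix_inv N))"
  proof (rule riccati_solution_from)
    fix t assume "t \<in> {t1..}"
    then show "det (mat 1 + M t ** - matrix_inv N) \<noteq> 0"
      using det_nu_nz[of t] det_nz_of_mult_eq_one[OF matrix_inv_mult(1)[OF det_N_nz]]
      by (simp add: one_plus_M_Zs det_mul)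
  qed auto
  then show ?thesis
    unfolding riccati_regular_def by (rule riccati_solution_on_cong) (simp add: Zs_eq)
qed

text \<open>The matrix in \<open>det_normal_nz\<close> is zero for \<open>Zs\<close>, hence
  singular.\<close>

lemma extremal_Zs: "riccati_extremal P Q R S t0 t1 Zs"
  using det_normal_nz[of Zs] regular_Zs by (auto simp: riccati_extremal_def Zs_t1 det_zero_matrix)

lemma Phi_Zs: "t1 \<le> t \<Longrightarrow> \<Phi> Zs t = \<Phi> Z0 t ** \<nu> t ** matrix_inv N"
  by (simp add: Phi_sol_regular[OF regular_Zs] Zs_t1 one_plus_M_Zs matrix_mul_assoc)

lemma Psi_Zs: "t1 \<le> t \<Longrightarrow> \<Psi> Zs t = matrix_inv N ** \<nu> t ** \<Psi> Z0 t"
  by (simp add: Psi_sol_regular[OF regular_Zs] Zs_t1 one_plus_M_Zs)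

section \<open>Divergence of the integral along the extremal solution\<close>

text \<open>Since \<nu> has derivative \<open>- K\<close>, the integrand \<open>N ** matrix_inv
  (\<nu> u) ** K u ** matrix_inv (\<nu> u) ** N\<close> is the derivative of
  \<open>N ** matrix_inv (\<nu> u) ** N\<close>.\<close>

lemma nu_partial_Zs:
  assumes t: "t1 \<le> t" "t \<le> T"
  shows "nu_partial P Q R t1 Zs t T = N ** (matrix_inv (\<nu> T) - matrix_inv (\<nu> t)) ** N"
proof -
  let ?k = "\<lambda>t. matrix_inv (\<Phi> Zs t) ** P t ** matrix_inv (\<Psi> Zs t)"
  have "(?k has_integral N ** matrix_inv (\<nu> T) ** N - N ** matrix_inv (\<nu> t) ** N) {t..T}"
  proof (rule fundamental_theorem_of_calculus[OF t(2)])
    fix u assume "u \<in> {t..T}"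
    then have u: "t1 \<le> u" using t by auto
    note nz = det_Phi_nz[OF reg0 u] det_Psi_nz[OF reg0 u] det_nu_nz[OF u] det_N_nz
    have "matrix_inv (\<Phi> Zs u) = N ** matrix_inv (\<nu> u) ** matrix_inv (\<Phi> Z0 u)"
      using nz by (intro matrix_inv_eqI)
        (simp add: Phi_Zs[OF u] matrix_mul_assoc matrix_inv_cancel_right matrix_inv_mult)
    moreover have "matrix_inv (\<Psi> Zs u) = matrix_inv (\<Psi> Z0 u) ** matrix_inv (\<nu> u) ** N"
      using nz by (intro matrix_inv_eqI)
        (simp add: Psi_Zs[OF u] matrix_mul_assoc matrix_inv_cancel_right matrix_inv_mult)
    ultimately have k: "?k u = N ** (matrix_inv (\<nu> u) ** K u ** matrix_inv (\<nu> u)) ** N"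
      by (simp add: K_def matrix_mul_assoc)
    have "((\<lambda>t. N ** matrix_inv (\<nu> t) ** N) has_vector_derivative ?k u) (at u within {t1..})"
      using matrix_mult.has_vector_derivative[OF matrix_mult.has_vector_derivative[OF has_vector_derivative_const
            has_vector_derivative_matrix_inv[OF nu_has_derivative[OF u] nz(3)]] has_vector_derivative_const, of N N]
      by (rule has_vector_derivative_eq_rhs)
         (simp add: k matrix_ring_simps matrix_mult.zero_left matrix_mult.zero_right)
    then show "((\<lambda>t. N ** matrix_inv (\<nu> t) ** N) has_vector_derivative ?k u) (at u within {t..T})"
      by (rule has_vector_derivative_within_subset) (use t in auto)
  qed
  then show ?thesis
    by (simp add: nu_partial_def integral_unique matrix_ring_simps)
qed

text \<open>As \<nu> tends to zero while its product with its inverse is the identity, the inverse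
  must be unbounded in norm along every sequence going to infinity; by \<open>nu_partial_Zs\<close>
  the integral inherits this growth.\<close>

lemma norm_nu_partial_Zs:
  assumes t: "t1 \<le> t"
  shows "filterlim (\<lambda>T. norm (nu_partial P Q R t1 Zs t T)) at_top at_top"
proof -
  let ?E = "nu_partial P Q R t1 Zs t" and ?N' = "matrix_inv N"
  obtain k where k: "k > 0" "\<And>(A :: complex^'n^'n) (B :: complex^'n^'n). norm (A ** B) \<le> norm A * norm B * k"
    using matrix_mult.pos_bounded by blast
  \<comment> \<open>Solving \<open>nu_partial_Zs\<close> for \<open>matrix_inv (\<nu> T)\<close>
    bounds its norm by \<open>a + b * norm (?E T)\<close>; the factors \<open>k\<close> in
    \<open>b\<close> come from the two matrix products.\<close>
  define a where "a = norm (matrix_inv (\<nu> t))"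
  define b where "b = norm ?N' * norm ?N' * k * k"
  have "b \<ge> 0" using k by (simp add: b_def)
  have low: "norm (mat 1 :: complex^'n^'n) \<le> norm (\<nu> T) * (a + b * norm (?E T)) * k" if "t \<le> T" for T
  proof -
    have "t1 \<le> T" using t that by simp
    have "matrix_inv (\<nu> T) = matrix_inv (\<nu> t) + ?N' ** ?E T ** ?N'"
      using det_N_nz by (simp add: nu_partial_Zs[OF t that] matrix_ring_simps matrix_inv_mult matrix_inv_cancel_right)
    then have "norm (matrix_inv (\<nu> T)) \<le> a + norm (?N' ** ?E T ** ?N')"
      by (simp add: a_def norm_triangle_ineq)
    also have "norm (?N' ** ?E T ** ?N') \<le> norm (?N' ** ?E T) * norm ?N' * k" by (rule k)
    also have "\<dots> \<le> (norm ?N' * norm (?E T) * k) * norm ?N' * k"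
      using k by (intro mult_right_mono k) auto
    finally have "norm (matrix_inv (\<nu> T)) \<le> a + b * norm (?E T)" by (simp add: b_def mult_ac)
    then have "norm (\<nu> T) * norm (matrix_inv (\<nu> T)) * k \<le> norm (\<nu> T) * (a + b * norm (?E T)) * k"
      using k by (intro mult_right_mono mult_left_mono) auto
    moreover have "norm (mat 1 :: complex^'n^'n) \<le> norm (\<nu> T) * norm (matrix_inv (\<nu> T)) * k"
      using k(2)[of "\<nu> T" "matrix_inv (\<nu> T)"] matrix_inv_mult[OF det_nu_nz[OF \<open>t1 \<le> T\<close>]] by simp
    ultimately show ?thesis by linarith
  qed
  show ?thesis
    unfolding filterlim_at_top_dense
  proof
    fix B :: real
    \<comment> \<open>If the integral had norm at most \<open>B\<close> at a late \<open>T\<close>,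
      \<open>low\<close> would bound the norm of the identity by this quantity, which tends to
      zero.\<close>
    have "((\<lambda>T. norm (\<nu> T) * (a + b * \<bar>B\<bar>) * k) \<longlongrightarrow> norm (0 :: complex^'n^'n) * (a + b * \<bar>B\<bar>) * k) at_top"
      by (intro tendsto_intros nu_tendsto)
    then have "((\<lambda>T. norm (\<nu> T) * (a + b * \<bar>B\<bar>) * k) \<longlongrightarrow> 0) at_top" by simp
    then have "eventually (\<lambda>T. norm (\<nu> T) * (a + b * \<bar>B\<bar>) * k < norm (mat 1 :: complex^'n^'n)) at_top"
      by (rule order_tendstoD(2)) (simp add: mat_1_neq_0)
    with eventually_ge_at_top[of t] show "eventually (\<lambda>T. B < norm (?E T)) at_top"
    proof eventually_elim
      case (elim T)
      show ?case
      proof (rule ccontr)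
        assume "\<not> ?case"
        then have "norm (\<nu> T) * (a + b * norm (?E T)) * k \<le> norm (\<nu> T) * (a + b * \<bar>B\<bar>) * k"
          using k \<open>b \<ge> 0\<close> by (intro mult_right_mono mult_left_mono add_left_mono) auto
        with low[OF elim(1)] elim(2) show False by linarith
      qed
    qed
  qed
qed

lemma matrix_norm_nu_partial_Zs:
  assumes n: "is_matrix_norm n" and t: "t1 \<le> t"
  shows "filterlim (\<lambda>T. n (nu_partial P Q R t1 Zs t T)) at_top at_top"
proof -
  obtain c where c: "c > 0" "\<And>A. c * norm A \<le> n A"
    using matrix_norm_ge[OF n] by blast
  have "filterlim (\<lambda>T. c * norm (nu_partial P Q R t1 Zs t T)) at_top at_top"
    by (rule filterlim_tendsto_pos_mult_at_top[OF tendsto_const c(1) norm_nu_partial_Zs[OF t]])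
  then show ?thesis
    by (rule filterlim_at_top_mono) (simp add: c(2))
qed

section \<open>The trace integral\<close>

text \<open>Integrated form of Liouville's formula; the boundary term at \<open>t1\<close> is the
  logarithm of one. The summand \<open>R\<close> cancels when two regular solutions are
  compared.\<close>

lemma integral_Re_trace_regular:
  assumes Z: "regular Z" and T: "t1 \<le> T"
  shows "((\<lambda>t. Re (trace (P t ** Z t + R t))) has_integral ln (cmod (det (\<Phi> Z T)))) {t1..T}"
proof -
  have "((\<lambda>t. Re (trace (P t ** Z t + R t))) has_integral
      ln (cmod (det (\<Phi> Z T))) - ln (cmod (det (\<Phi> Z t1)))) {t1..T}"
  proof (rule fundamental_theorem_of_calculus[OF T])
    fix u assume u: "u \<in> {t1..T}"
    then have "((\<lambda>t. ln (cmod (det (\<Phi> Z t)))) has_vector_derivative Re (trace (P u ** Z u + R u))) (at u within {t1..})"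
      using liouville_ln_norm_det[OF Phi_sol_props(2)[OF Z] det_Phi_nz[OF Z]]
      by (simp add: has_real_derivative_iff_has_vector_derivative)
    then show "((\<lambda>t. ln (cmod (det (\<Phi> Z t)))) has_vector_derivative Re (trace (P u ** Z u + R u))) (at u within {t1..T})"
      by (rule has_vector_derivative_within_subset) auto
  qed
  then show ?thesis by (simp add: Phi_sol_props[OF Z])
qed

text \<open>The common factor \<open>det (\<Phi> Z0 T)\<close> drops out of the two determinants,
  leaving \<open>ln (f T) - ln (g T)\<close>. Here \<open>f\<close> tends to zero together with
  \<nu>, whereas \<open>g\<close> has a positive limit.\<close>

lemma integral_Re_trace_diff:
  assumes Z: "riccati_normal P Q R S t0 t1 Z"
  shows "filterlim (\<lambda>T. integral {t1..T} (\<lambda>t. Re (trace (P t ** (Zs t - Z t))))) at_bot at_top"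
proof -
  let ?\<Lambda> = "Z t1 - Z0 t1" and ?I = "\<lambda>T. integral {t1..T} (\<lambda>t. Re (trace (P t ** (Zs t - Z t))))"
  have regZ: "regular Z" using Z by (simp add: riccati_normal_def)
  define f where "f T = cmod (det (\<nu> T ** matrix_inv N))" for T
  define g where "g T = cmod (det (mat 1 + M T ** ?\<Lambda>))" for T
  have fpos: "f T > 0" if "t1 \<le> T" for T
    using det_nu_nz[OF that] det_nz_of_mult_eq_one[OF matrix_inv_mult(1)[OF det_N_nz]]
    by (simp add: f_def det_mul)
  have gpos: "g T > 0" if "t1 \<le> T" for T
    using det_one_plus_M_nz[OF regZ that] by (simp add: g_def)
  have I: "?I T = ln (f T) - ln (g T)" if T: "t1 \<le> T" for T
  proof -
    have "((\<lambda>t. Re (trace (P t ** Zs t + R t)) - Re (trace (P t ** Z t + R t))) has_integral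
        ln (cmod (det (\<Phi> Zs T))) - ln (cmod (det (\<Phi> Z T)))) {t1..T}"
      by (intro has_integral_diff integral_Re_trace_regular regular_Zs regZ T)
    moreover have "(\<lambda>t. Re (trace (P t ** Zs t + R t)) - Re (trace (P t ** Z t + R t)))
        = (\<lambda>t. Re (trace (P t ** (Zs t - Z t))))"
      by (simp add: fun_eq_iff trace_add trace_sub matrix_mult.diff_right)
    ultimately have "?I T = ln (cmod (det (\<Phi> Zs T))) - ln (cmod (det (\<Phi> Z T)))"
      by (simp add: integral_unique)
    also have "cmod (det (\<Phi> Zs T)) = cmod (det (\<Phi> Z0 T)) * f T"
      by (simp add: Phi_Zs[OF T] f_def det_mul norm_mult)
    also have "cmod (det (\<Phi> Z T)) = cmod (det (\<Phi> Z0 T)) * g T"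
      by (simp add: Phi_sol_regular[OF regZ T] g_def det_mul norm_mult)
    also have "ln (cmod (det (\<Phi> Z0 T)) * f T) - ln (cmod (det (\<Phi> Z0 T)) * g T) = ln (f T) - ln (g T)"
      using fpos[OF T] gpos[OF T] det_Phi_nz[OF reg0 T] by (simp add: ln_mult_pos)
    finally show ?thesis .
  qed
  have "((\<lambda>T. \<nu> T ** matrix_inv N) \<longlongrightarrow> 0 ** matrix_inv N) at_top"
    by (intro matrix_mult.tendsto nu_tendsto tendsto_const)
  from tendsto_norm[OF tendsto_det[OF this]]
  have "(f \<longlongrightarrow> 0) at_top"
    by (simp add: f_def[abs_def] matrix_mult.zero_left det_zero_matrix)
  moreover have "eventually (\<lambda>T. f T \<in> {0<..} \<and> f T \<noteq> 0) at_top"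
    using eventually_ge_at_top[of t1] by eventually_elim (use fpos in force)
  ultimately have "filterlim f (at_right 0) at_top"
    by (simp add: filterlim_at)
  then have lnf: "filterlim (\<lambda>T. ln (f T)) at_bot at_top"
    by (rule filterlim_compose[OF ln_at_0])
  \<comment> \<open>Normality enters here: the factorization reduces the nonvanishing of the limit
    of \<open>g\<close> to \<open>det_normal_nz\<close>.\<close>
  have "mat 1 + N ** ?\<Lambda> = N ** (?\<Lambda> + matrix_inv N)"
    using det_N_nz by (simp add: matrix_mult.add_right matrix_inv_mult add.commute)
  then have "det (mat 1 + N ** ?\<Lambda>) \<noteq> 0"
    using det_normal_nz[OF Z] det_N_nz by (simp add: det_mul)
  moreover have "(g \<longlongrightarrow> cmod (det (mat 1 + N ** ?\<Lambda>))) at_top"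
    unfolding g_def[abs_def]
    by (intro tendsto_norm tendsto_det tendsto_add tendsto_const matrix_mult.tendsto M_tendsto)
  ultimately have "((\<lambda>T. ln (g T)) \<longlongrightarrow> ln (cmod (det (mat 1 + N ** ?\<Lambda>)))) at_top"
    by (intro tendsto_intros) auto
  moreover have "filterlim (\<lambda>T. - ln (f T)) at_top at_top"
    using lnf by (simp add: filterlim_uminus_at_bot)
  ultimately have "filterlim (\<lambda>T. ln (g T) + - ln (f T)) at_top at_top"
    by (rule filterlim_tendsto_add_at_top)
  then have "filterlim (\<lambda>T. ln (f T) - ln (g T)) at_bot at_top"
    by (simp add: filterlim_uminus_at_bot)
  moreover have "eventually (\<lambda>T. ln (f T) - ln (g T) = ?I T) at_top"
    using eventually_ge_at_top[of t1] by eventually_elim (simp add: I)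
  ultimately show ?thesis
    using filterlim_cong[OF refl refl, of "\<lambda>T. ln (f T) - ln (g T)" ?I at_top at_bot] by blast
qed

end

theorem theorem3p3:
  fixes P Q R S :: "real \<Rightarrow> complex^'n^'n" and t0 t1 :: real
    and Z0 Zs :: "real \<Rightarrow> complex^'n^'n"
  assumes cont: "continuous_on {t0..} P" "continuous_on {t0..} Q"
      "continuous_on {t0..} R" "continuous_on {t0..} S"
    and two_regular: "\<exists>t1'\<ge>t0. \<exists>Z W. riccati_regular P Q R S t0 t1' Z \<and>
      riccati_regular P Q R S t0 t1' W \<and> (\<exists>t\<ge>t1'. Z t \<noteq> W t)"
    and t1: "t0 \<le> t1"
    and reg: "riccati_regular P Q R S t0 t1 Z0"
    and conv: "nu_convergent P Q R t1 Z0 t1"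
    and det_nz: "\<And>t. t1 \<le> t \<Longrightarrow> det (nu P Q R t1 Z0 t) \<noteq> 0"
  defines "Zs \<equiv> \<lambda>t. Z0 t -
      matrix_inv (Phi_sol P R t1 Z0 t ** nu P Q R t1 Z0 t ** Psi_sol P Q t1 Z0 t)"
  shows "riccati_extremal P Q R S t0 t1 Zs \<and>
    (\<forall>N. is_matrix_norm N \<longrightarrow>
      (\<forall>t\<ge>t1. filterlim (\<lambda>T. N (nu_partial P Q R t1 Zs t T)) at_top at_top)) \<and>
    (\<forall>ZN. riccati_normal P Q R S t0 t1 ZN \<longrightarrow>
      filterlim (\<lambda>T. integral {t1..T} (\<lambda>\<tau>. Re (trace (P \<tau> ** (Zs \<tau> - ZN \<tau>))))) at_bot at_top)"
proof -
  interpret ref: riccati_nu P Q R S t0 t1 Z0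
    using cont t1 reg conv det_nz by unfold_locales auto
  have "Zs = ref.Zs"
    by (simp add: Zs_def ref.Zs_def fun_eq_iff)
  then show ?thesis
    using ref.extremal_Zs ref.matrix_norm_nu_partial_Zs ref.integral_Re_trace_diff by simp
qed

end
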